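(* Let $X$ be a real Hilbert space, let $A, B\colon X\rightrightarrows X$ be maximally monotone, let $\lambda\in\,]0,1]$, set $T_\lambda=(1-\lambda)\mathrm{Id}+\lambda R_BR_A$, and let $(x,y)\in X\times X$. Then $$\lambda\|x-y\|^2-\lambda\|T_\lambda x-T_\lambda y\|^2-(1-\lambda)\|(\mathrm{Id}-T_\lambda)x-(\mathrm{Id}-T_\lambda)y\|^2$$ $$=4\lambda^2\langle J_Ax-J_Ay,\,J_{A^{-1}}x-J_{A^{-1}}y\rangle+4\lambda^2\langle J_BR_Ax-J_BR_Ay,\,J_{B^{-1}}R_Ax-J_{B^{-1}}R_Ay\rangle.$$ Consequently: (i) $\|x-y\|^2-\|T_\lambda x-T_\lambda y\|^2\ge 4\lambda\langle J_Ax-J_Ay,\,J_{A^{-1}}x-J_{A^{-1}}y\rangle$. (ii) $\|x-y\|^2-\|T_\lambda x-T_\lambda y\|^2\ge 4\lambda\langle J_BR_Ax-J_BR_Ay,\,J_{B^{-1}}R_Ax-J_{B^{-1}}R_Ay\rangle$.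
   Context: For a maximally monotone operator $C\colon X\rightrightarrows X$: $J_C=(\mathrm{Id}+C)^{-1}$ is the resolvent (single-valued with full domain), $R_C=2J_C-\mathrm{Id}$ is the reflected resolvent, and $C^{-1}$ is the set-valued inverse of $C$ (also maximally monotone), with resolvent $J_{C^{-1}}=(\mathrm{Id}+C^{-1})^{-1}$. *)

theory Defs
  imports "HOL-Analysis.Analysis"
begin

text \<open>A set-valued operator from a space to itself is a function of type \<open>'a \<Rightarrow> 'a set\<close>;
  its graph is the set of pairs \<open>(x, u)\<close> with \<open>u \<in> C x\<close>.
  A real Hilbert space is a type of class \<open>real_inner\<close> and \<open>complete_space\<close>.\<close>

definition monotone_operator :: "('a::real_inner \<Rightarrow> 'a set) \<Rightarrow> bool" where
  "monotone_operator C \<longleftrightarrow>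
     (\<forall>x y. \<forall>u\<in>C x. \<forall>v\<in>C y. 0 \<le> inner (x - y) (u - v))"

text \<open>Maximality is with respect to inclusion of graphs.\<close>

definition maximally_monotone :: "('a::real_inner \<Rightarrow> 'a set) \<Rightarrow> bool" where
  "maximally_monotone C \<longleftrightarrow>
     monotone_operator C \<and>
     (\<forall>D. monotone_operator D \<and> (\<forall>x. C x \<subseteq> D x) \<longrightarrow> D = C)"

definition inverse_operator :: "('a \<Rightarrow> 'a set) \<Rightarrow> 'a \<Rightarrow> 'a set" where
  "inverse_operator C u = {x. u \<in> C x}"

definition id_operator :: "'a \<Rightarrow> 'a set" where
  "id_operator x = {x}"

definition sum_operator ::
    "('a::real_vector \<Rightarrow> 'a set) \<Rightarrow> ('a \<Rightarrow> 'a set) \<Rightarrow> 'a \<Rightarrow> 'a set" where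
  "sum_operator C D x = {u + v | u v. u \<in> C x \<and> v \<in> D x}"

text \<open>The value of the resolvent \<open>J\<^sub>C = (Id + C)\<^sup>-\<^sup>1\<close> at \<open>x\<close> is the unique element of the set
  \<open>(Id + C)\<^sup>-\<^sup>1 x\<close>. For maximally monotone \<open>C\<close> on a Hilbert space this set is a singleton
  for every \<open>x\<close> by Minty's theorem; otherwise the value may be unspecified.\<close>

definition resolvent :: "('a::real_vector \<Rightarrow> 'a set) \<Rightarrow> 'a \<Rightarrow> 'a" where
  "resolvent C x = (THE p. p \<in> inverse_operator (sum_operator id_operator C) x)"

definition reflected_resolvent :: "('a::real_vector \<Rightarrow> 'a set) \<Rightarrow> 'a \<Rightarrow> 'a" where
  "reflected_resolvent C x = 2 *\<^sub>R resolvent C x - x"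

end

theory Submission
  imports Defs
begin

text \<open>Once \<open>J\<^sub>C z + J\<^sub>C\<^sub>-\<^sub>1 z = z\<close> is known, the identity
  \<open>\<parallel>x - y\<parallel>\<^sup>2 - \<parallel>R\<^sub>C x - R\<^sub>C y\<parallel>\<^sup>2 = 4 \<langle>J\<^sub>C x - J\<^sub>C y, J\<^sub>C\<^sub>-\<^sub>1 x - J\<^sub>C\<^sub>-\<^sub>1 y\<rangle>\<close>
  is inner product algebra and telescopes over \<open>R\<^sub>A\<close> and \<open>R\<^sub>B\<close>; the two inequalities then
  drop nonnegative terms. The analytic content is Minty's theorem, that resolvents have full domain.
  A solution of \<open>z - p \<in> C p\<close> is a point \<open>p\<close> with \<open>\<langle>p - x, p - v\<rangle> \<le> 0\<close> for all \<open>u \<in> C x\<close>,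
  where \<open>v = z - u\<close>. Each of these conditions reads \<open>c - \<parallel>q\<parallel>\<^sup>2 + \<parallel>p - q\<parallel>\<^sup>2 \<le> 0\<close> with
  \<open>q = (x + v) / 2\<close> and \<open>c = \<langle>x, v\<rangle>\<close>. The function \<open>(q, c) \<mapsto> c - \<parallel>q\<parallel>\<^sup>2\<close> is nonpositive on the
  convex hull of these pairs by monotonicity, and it is strongly concave in \<open>q\<close>. Hence the
  \<open>q\<close>-components of a maximizing sequence converge, and their limit is the required \<open>p\<close>.\<close>

section \<open>Convex sets below a paraboloid\<close>

lemma norm_convex_combination_squared:
  fixes a b :: "'a::real_inner"
  shows "(norm ((1 - t) *\<^sub>R a + t *\<^sub>R b))\<^sup>2
    = (1 - t) * (norm a)\<^sup>2 + t * (norm b)\<^sup>2 - t * (1 - t) * (norm (a - b))\<^sup>2"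
  unfolding power2_norm_eq_inner
  by (simp add: inner_diff_left inner_diff_right inner_add_left inner_add_right inner_commute
      algebra_simps power2_eq_square)

lemma convex_below_paraboloid_translate:
  fixes H :: "('a::{real_inner, complete_space} \<times> real) set"
  assumes "convex H" and below: "\<And>q c. (q, c) \<in> H \<Longrightarrow> c \<le> (norm q)\<^sup>2"
  obtains p where "\<And>q c. (q, c) \<in> H \<Longrightarrow> c - (norm q)\<^sup>2 + (norm (p - q))\<^sup>2 \<le> 0"
proof (cases "H = {}")
  case True
  then show ?thesis using that by blast
next
  case False
  define g where "g h = snd h - (norm (fst h))\<^sup>2" for h :: "'a \<times> real"
  define s where "s = (SUP h\<in>H. g h)"
  have bdd: "bdd_above (g ` H)"
    by (rule bdd_aboveI2[where M = 0]) (use below in \<open>auto simp: g_def\<close>)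
  have g_le: "g h \<le> s" if "h \<in> H" for h
    unfolding s_def by (rule cSUP_upper[OF that bdd])
  have s_le: "s \<le> 0"
    unfolding s_def by (rule cSUP_least[OF False]) (use below in \<open>auto simp: g_def\<close>)
  \<comment> \<open>Used twice: \<open>t = 1/2\<close> makes the maximizing sequence Cauchy, and
    \<open>t\<close> tending to 0 gives the optimality inequality at its limit.\<close>
  have concave: "(1 - t) * g h + t * g k + t * (1 - t) * (norm (fst h - fst k))\<^sup>2 \<le> s"
    if "h \<in> H" "k \<in> H" "0 \<le> t" "t \<le> 1" for h k t
  proof -
    have "(1 - t) *\<^sub>R h + t *\<^sub>R k \<in> H"
      using \<open>convex H\<close> that by (simp add: convex_alt)
    from g_le[OF this] show ?thesis
      unfolding g_def fst_add snd_add fst_scaleR snd_scaleR norm_convex_combination_squared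
      by (simp add: algebra_simps)
  qed
  have "\<exists>h\<in>H. s - 1 / Suc n < g h" for n
    using less_cSUP_iff[OF False bdd, of "s - 1 / Suc n"] unfolding s_def by simp
  then obtain h where hH: "\<And>n. h n \<in> H" and h: "\<And>n. s - 1 / Suc n < g (h n)"
    by metis
  have g_lim: "(\<lambda>n. g (h n)) \<longlonglongrightarrow> s"
  proof (rule tendsto_sandwich)
    show "(\<lambda>n. s - 1 / real (Suc n)) \<longlonglongrightarrow> s"
      using tendsto_diff[OF tendsto_const LIMSEQ_inverse_real_of_nat, of s]
      by (simp add: inverse_eq_divide)
    show "(\<lambda>n. s) \<longlonglongrightarrow> s"
      by (rule tendsto_const)
  qed (use g_le[OF hH] h[THEN less_imp_le] in \<open>simp_all del: of_nat_Suc\<close>)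
  have "Cauchy (\<lambda>n. fst (h n))"
  proof (rule CauchyI)
    fix e :: real assume "0 < e"
    then obtain N where N: "1 / real (Suc N) < e\<^sup>2 / 4"
      using nat_approx_posE[of "e\<^sup>2 / 4"] by auto
    show "\<exists>M. \<forall>m\<ge>M. \<forall>n\<ge>M. norm (fst (h m) - fst (h n)) < e"
    proof (intro exI[of _ N] allI impI)
      fix m n assume "N \<le> m" "N \<le> n"
      have tail: "s - e\<^sup>2 / 4 < g (h k)" if "N \<le> k" for k
      proof -
        have "1 / real (Suc k) \<le> 1 / real (Suc N)"
          using that by (simp add: frac_le)
        then show ?thesis using h[of k] N by linarith
      qed
      \<comment> \<open>At the midpoint the quadratic term has weight 1/4, while the average of the
        two values exceeds \<open>s - e\<^sup>2 / 4\<close>.\<close>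
      have "(norm (fst (h m) - fst (h n)))\<^sup>2 < e\<^sup>2"
        using concave[OF hH[of m] hH[of n], of "1/2"] tail[OF \<open>N \<le> m\<close>] tail[OF \<open>N \<le> n\<close>]
        by simp
      then show "norm (fst (h m) - fst (h n)) < e"
        using \<open>0 < e\<close> by (simp add: power_less_imp_less_base)
    qed
  qed
  then obtain p where p: "(\<lambda>n. fst (h n)) \<longlonglongrightarrow> p"
    using Cauchy_convergent convergent_def by blast
  show ?thesis
  proof (rule that)
    fix q c assume k: "(q, c) \<in> H"
    \<comment> \<open>The limit \<open>p\<close> need not come from a point of \<open>H\<close>, so
      \<open>concave\<close> is passed to the limit along \<open>h\<close> with \<open>t\<close>
      fixed, and only then divided by \<open>t\<close>.\<close>
    have step: "c - (norm q)\<^sup>2 + (1 - t) * (norm (p - q))\<^sup>2 \<le> s" if t: "0 < t" "t \<le> 1" for t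
    proof -
      have "(\<lambda>n. (1 - t) * g (h n) + t * g (q, c) + t * (1 - t) * (norm (fst (h n) - q))\<^sup>2)
          \<longlonglongrightarrow> (1 - t) * s + t * g (q, c) + t * (1 - t) * (norm (p - q))\<^sup>2"
        by (intro tendsto_intros g_lim p)
      then have "(1 - t) * s + t * g (q, c) + t * (1 - t) * (norm (p - q))\<^sup>2 \<le> s"
        by (rule LIMSEQ_le_const2) (use concave[OF hH k] t in auto)
      then have "t * (g (q, c) + (1 - t) * (norm (p - q))\<^sup>2) \<le> t * s"
        by (simp add: algebra_simps)
      then show ?thesis using t by (simp add: g_def)
    qed
    have "(\<lambda>n. c - (norm q)\<^sup>2 + (1 - 1 / real (Suc n)) * (norm (p - q))\<^sup>2)
        \<longlonglongrightarrow> c - (norm q)\<^sup>2 + (1 - 0) * (norm (p - q))\<^sup>2"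
      using LIMSEQ_inverse_real_of_nat
      by (intro tendsto_intros) (simp add: inverse_eq_divide)
    then have "c - (norm q)\<^sup>2 + (1 - 0) * (norm (p - q))\<^sup>2 \<le> s"
      by (rule LIMSEQ_le_const2) (auto intro!: step)
    then show "c - (norm q)\<^sup>2 + (norm (p - q))\<^sup>2 \<le> 0"
      using s_le by simp
  qed
qed

section \<open>Convex hull of an antimonotone relation\<close>

lemma antimonotone_hull_le_inner:
  fixes G :: "('a::real_inner \<times> 'a) set"
  assumes anti: "\<And>x v y w. (x, v) \<in> G \<Longrightarrow> (y, w) \<in> G \<Longrightarrow> inner (x - y) (v - w) \<le> 0"
    and mem: "(a, b, c) \<in> convex hull ((\<lambda>(x, v). (x, v, inner x v)) ` G)"
  shows "c \<le> inner a b"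
proof -
  \<comment> \<open>The condition that extends \<open>anti\<close> to the hull is affine in each triple separately.\<close>
  define K where "K = convex hull ((\<lambda>(x, v). (x, v, inner x v)) ` G)"
  define Q where "Q a b c = {(a', b', c'). c + c' - inner a b' - inner a' b \<le> 0}"
    for a b :: 'a and c :: real
  have cvx: "convex (Q a b c)" for a b c
  proof -
    have lin: "linear (\<lambda>k::'a \<times> 'a \<times> real. snd (snd k) - inner a (fst (snd k)) - inner (fst k) b)"
      by (rule linearI) (simp_all add: inner_add_left inner_add_right algebra_simps)
    have "Q a b c = (\<lambda>k. snd (snd k) - inner a (fst (snd k)) - inner (fst k) b) -` {..-c}"
      by (auto simp: Q_def)
    then show ?thesis
      using convex_linear_vimage[OF lin, of "{..-c}"] by simp
  qed
  \<comment> \<open>On two generators the condition in \<open>Q\<close> is exactly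
    \<open>inner (x - y) (v - w) \<le> 0\<close>.\<close>
  have point: "K \<subseteq> Q x v (inner x v)" if "(x, v) \<in> G" for x v
    unfolding K_def
  proof (rule hull_minimal)
    show "(\<lambda>(x, v). (x, v, inner x v)) ` G \<subseteq> Q x v (inner x v)"
      using anti[OF that] by (force simp: Q_def inner_diff_left inner_diff_right)
  qed (rule cvx)
  \<comment> \<open>The condition is symmetric in the two triples, so \<open>point\<close> puts
    every generator into \<open>Q a b c\<close>.\<close>
  have "K \<subseteq> Q a b c"
    unfolding K_def
  proof (rule hull_minimal)
    show "(\<lambda>(x, v). (x, v, inner x v)) ` G \<subseteq> Q a b c"
      using point mem by (fastforce simp: K_def Q_def)
  qed (rule cvx)
  \<comment> \<open>On the diagonal the condition reads
    \<open>2 * (c - inner a b) \<le> 0\<close>.\<close>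
  then show ?thesis using mem by (auto simp: K_def Q_def)
qed

section \<open>Minty's theorem\<close>

text \<open>Adjoining \<open>(p, w)\<close> to the graph preserves monotonicity, so by maximality
  the pair was already there.\<close>

lemma maximally_monotone_memI:
  assumes "maximally_monotone C"
    and rel: "\<And>x u. u \<in> C x \<Longrightarrow> 0 \<le> inner (p - x) (w - u)"
  shows "w \<in> C p"
proof -
  define D where "D = C(p := insert w (C p))"
  have rel': "0 \<le> inner (x - p) (u - w)" if "u \<in> C x" for x u
    using rel[OF that] by (simp add: inner_diff_left inner_diff_right)
  have "monotone_operator C"
    using assms(1) by (simp add: maximally_monotone_def)
  then have "monotone_operator D"
    unfolding monotone_operator_def D_def using rel rel' by auto
  moreover have "\<forall>x. C x \<subseteq> D x"
    by (auto simp: D_def)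
  ultimately have "D = C"
    using assms(1) unfolding maximally_monotone_def by blast
  then show ?thesis
    by (metis D_def fun_upd_same insertI1)
qed

theorem Minty:
  fixes C :: "'a::{real_inner, complete_space} \<Rightarrow> 'a set"
  assumes "maximally_monotone C"
  obtains p where "z - p \<in> C p"
proof -
  define G where "G = {(x, z - u) | x u. u \<in> C x}"
  define K where "K = convex hull ((\<lambda>(x, v). (x, v, inner x v)) ` G)"
  \<comment> \<open>The triples keep \<open>x\<close> and \<open>v\<close> apart for the hull bound
    by \<open>inner a b\<close>; the linear map \<open>f\<close> then passes to midpoints.\<close>
  define f where "f k = ((1 / 2) *\<^sub>R (fst k + fst (snd k)), snd (snd k))"
    for k :: "'a \<times> 'a \<times> real"
  have anti: "inner (x - y) (v - w) \<le> 0" if mem: "(x, v) \<in> G" "(y, w) \<in> G" for x v y w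
  proof -
    obtain u u' where "v = z - u" "u \<in> C x" "w = z - u'" "u' \<in> C y"
      using mem unfolding G_def by blast
    moreover from this have "0 \<le> inner (x - y) (u - u')"
      using assms by (auto simp: maximally_monotone_def monotone_operator_def)
    ultimately show ?thesis
      by (simp add: inner_diff_right)
  qed
  have "linear f"
    by (rule linearI) (simp_all add: f_def algebra_simps)
  then have "convex (f ` K)"
    unfolding K_def by (intro convex_linear_image convex_convex_hull)
  moreover have "c \<le> (norm q)\<^sup>2" if "(q, c) \<in> f ` K" for q c
  proof -
    obtain a b where q: "q = (1 / 2) *\<^sub>R (a + b)" and "(a, b, c) \<in> K"
      using \<open>(q, c) \<in> f ` K\<close> by (auto simp: f_def)
    then have "c \<le> inner a b"
      using antimonotone_hull_le_inner[OF anti] by (simp add: K_def)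
    also have "\<dots> = (norm q)\<^sup>2 - (norm ((1 / 2) *\<^sub>R (a - b)))\<^sup>2"
      unfolding q power2_norm_eq_inner
      by (simp add: inner_add_left inner_add_right inner_diff_left inner_diff_right inner_commute
          field_simps)
    finally show ?thesis
      using zero_le_power2[of "norm ((1 / 2) *\<^sub>R (a - b))"] by linarith
  qed
  ultimately obtain p where
    p: "\<And>q c. (q, c) \<in> f ` K \<Longrightarrow> c - (norm q)\<^sup>2 + (norm (p - q))\<^sup>2 \<le> 0"
    using convex_below_paraboloid_translate by blast
  have "0 \<le> inner (p - x) (z - p - u)" if "u \<in> C x" for x u
  proof -
    define v where "v = z - u"
    have "(x, v, inner x v) \<in> K"
      unfolding K_def using that by (intro hull_inc) (auto simp: G_def v_def)
    then have "((1 / 2) *\<^sub>R (x + v), inner x v) \<in> f ` K"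
      by (force simp: f_def)
    from p[OF this] have "inner (p - x) (p - v) \<le> 0"
      unfolding power2_norm_eq_inner
      by (simp add: inner_add_left inner_add_right inner_diff_left inner_diff_right inner_commute)
    then show ?thesis
      by (simp add: v_def inner_diff_right)
  qed
  from maximally_monotone_memI[OF assms this] show ?thesis
    by (rule that)
qed

section \<open>Resolvents and reflected resolvents\<close>

lemma resolvent_set_iff:
  "p \<in> inverse_operator (sum_operator id_operator C) z \<longleftrightarrow> z - p \<in> C p"
  by (force simp: inverse_operator_def sum_operator_def id_operator_def)

text \<open>Uniqueness for \<open>THE\<close>: the images of two solutions \<open>p\<close>,
  \<open>q\<close> differ by \<open>-(q - p)\<close>, which monotonicity permits only if
  \<open>q = p\<close>.\<close>

lemma resolvent_eqI:
  assumes "monotone_operator C" and "z - p \<in> C p"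
  shows "resolvent C z = p"
  unfolding resolvent_def resolvent_set_iff
proof (rule the_equality)
  show "z - p \<in> C p" by (rule assms(2))
next
  fix q assume "z - q \<in> C q"
  then have "0 \<le> inner (q - p) ((z - q) - (z - p))"
    using assms unfolding monotone_operator_def by blast
  also have "\<dots> = - inner (q - p) (q - p)"
    by (simp add: inner_diff_right)
  finally have "inner (q - p) (q - p) \<le> 0"
    by simp
  then show "q = p"
    by (metis inner_eq_zero_iff inner_ge_zero order_antisym right_minus_eq)
qed

lemma resolvent_mem:
  fixes C :: "'a::{real_inner, complete_space} \<Rightarrow> 'a set"
  assumes "maximally_monotone C"
  shows "z - resolvent C z \<in> C (resolvent C z)"
proof -
  obtain p where "z - p \<in> C p"
    using Minty[OF assms] .
  then show ?thesis
    using resolvent_eqI assms by (metis maximally_monotone_def)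
qed

lemma monotone_inverse_operator:
  "monotone_operator C \<Longrightarrow> monotone_operator (inverse_operator C)"
  unfolding monotone_operator_def inverse_operator_def by (metis inner_commute mem_Collect_eq)

text \<open>With \<open>p = resolvent C z\<close>, the relation \<open>z - p \<in> C p\<close> also
  says that \<open>z - p\<close> solves the resolvent equation of the inverse.\<close>

lemma resolvent_inverse_operator:
  fixes C :: "'a::{real_inner, complete_space} \<Rightarrow> 'a set"
  assumes "maximally_monotone C"
  shows "resolvent (inverse_operator C) z = z - resolvent C z"
proof (rule resolvent_eqI)
  show "monotone_operator (inverse_operator C)"
    using assms by (simp add: maximally_monotone_def monotone_inverse_operator)
qed (use resolvent_mem[OF assms] in \<open>simp add: inverse_operator_def\<close>)

lemma inner_resolvents_nonneg:
  fixes C :: "'a::{real_inner, complete_space} \<Rightarrow> 'a set"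
  assumes "maximally_monotone C"
  shows "0 \<le> inner (resolvent C x - resolvent C y)
    (resolvent (inverse_operator C) x - resolvent (inverse_operator C) y)"
  using resolvent_mem[OF assms] assms
  unfolding resolvent_inverse_operator[OF assms] maximally_monotone_def monotone_operator_def
  by blast

text \<open>If \<open>p\<close> and \<open>q\<close> are the differences of the two resolvents, then
  \<open>x - y = p + q\<close> and the reflected difference is \<open>p - q\<close>.\<close>

lemma reflected_resolvent_norm_diff:
  fixes C :: "'a::{real_inner, complete_space} \<Rightarrow> 'a set"
  assumes "maximally_monotone C"
  shows "(norm (x - y))\<^sup>2 - (norm (reflected_resolvent C x - reflected_resolvent C y))\<^sup>2
    = 4 * inner (resolvent C x - resolvent C y)
        (resolvent (inverse_operator C) x - resolvent (inverse_operator C) y)"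
  unfolding resolvent_inverse_operator[OF assms] reflected_resolvent_def power2_norm_eq_inner
  by (simp add: inner_diff_left inner_diff_right inner_commute algebra_simps)

section \<open>Relaxation and the final estimates\<close>

text \<open>Expanding the convex combination produces
  \<open>t\<^sup>2 * (1 - t) * (norm (d - r))\<^sup>2\<close>, which the last term on the left
  cancels.\<close>

lemma relaxation_norm_identity:
  fixes d r :: "'a::real_inner"
  shows "t * (norm d)\<^sup>2 - t * (norm ((1 - t) *\<^sub>R d + t *\<^sub>R r))\<^sup>2
      - (1 - t) * (norm (t *\<^sub>R (d - r)))\<^sup>2
    = t\<^sup>2 * ((norm d)\<^sup>2 - (norm r)\<^sup>2)"
  unfolding norm_convex_combination_squared norm_scaleR power_mult_distrib power2_abs
  by (simp add: algebra_simps power2_eq_square)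

theorem lemma3p6:
  fixes A B :: "'a::{real_inner, complete_space} \<Rightarrow> 'a set"
    and T :: "'a \<Rightarrow> 'a" and lam :: real and x y :: 'a
  assumes "maximally_monotone A" and "maximally_monotone B"
    and "0 < lam" and "lam \<le> 1"
    and "T = (\<lambda>z. (1 - lam) *\<^sub>R z
                   + lam *\<^sub>R (reflected_resolvent B \<circ> reflected_resolvent A) z)"
  shows
    "lam * (norm (x - y))\<^sup>2 - lam * (norm (T x - T y))\<^sup>2
       - (1 - lam) * (norm ((x - T x) - (y - T y)))\<^sup>2
     = 4 * lam\<^sup>2 *
         inner (resolvent A x - resolvent A y)
               (resolvent (inverse_operator A) x - resolvent (inverse_operator A) y)
     + 4 * lam\<^sup>2 *
         inner (resolvent B (reflected_resolvent A x) - resolvent B (reflected_resolvent A y))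
               (resolvent (inverse_operator B) (reflected_resolvent A x)
                - resolvent (inverse_operator B) (reflected_resolvent A y))
     \<and> (norm (x - y))\<^sup>2 - (norm (T x - T y))\<^sup>2
       \<ge> 4 * lam *
         inner (resolvent A x - resolvent A y)
               (resolvent (inverse_operator A) x - resolvent (inverse_operator A) y)
     \<and> (norm (x - y))\<^sup>2 - (norm (T x - T y))\<^sup>2
       \<ge> 4 * lam *
         inner (resolvent B (reflected_resolvent A x) - resolvent B (reflected_resolvent A y))
               (resolvent (inverse_operator B) (reflected_resolvent A x)
                - resolvent (inverse_operator B) (reflected_resolvent A y))"
proof -
  define RA RB where "RA = reflected_resolvent A" and "RB = reflected_resolvent B"
  define a where "a = inner (resolvent A x - resolvent A y)
    (resolvent (inverse_operator A) x - resolvent (inverse_operator A) y)"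
  define b where "b = inner (resolvent B (RA x) - resolvent B (RA y))
    (resolvent (inverse_operator B) (RA x) - resolvent (inverse_operator B) (RA y))"
  have T: "T z = (1 - lam) *\<^sub>R z + lam *\<^sub>R RB (RA z)" for z
    using assms(5) by (simp add: RA_def RB_def)
  have diff: "T x - T y = (1 - lam) *\<^sub>R (x - y) + lam *\<^sub>R (RB (RA x) - RB (RA y))"
    by (simp add: T algebra_simps)
  have codiff: "(x - T x) - (y - T y) = lam *\<^sub>R ((x - y) - (RB (RA x) - RB (RA y)))"
    by (simp add: T algebra_simps)
  have "(norm (x - y))\<^sup>2 - (norm (RB (RA x) - RB (RA y)))\<^sup>2 = 4 * a + 4 * b"
    using reflected_resolvent_norm_diff[OF assms(1), of x y]
      reflected_resolvent_norm_diff[OF assms(2), of "RA x" "RA y"]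
    by (simp add: a_def b_def RA_def RB_def)
  then have eq: "lam * (norm (x - y))\<^sup>2 - lam * (norm (T x - T y))\<^sup>2
      - (1 - lam) * (norm ((x - T x) - (y - T y)))\<^sup>2 = 4 * lam\<^sup>2 * a + 4 * lam\<^sup>2 * b"
    unfolding diff codiff relaxation_norm_identity by (simp add: algebra_simps)
  have "0 \<le> (1 - lam) * (norm ((x - T x) - (y - T y)))\<^sup>2"
    using assms(4) by simp
  with eq have "lam * (4 * lam * a + 4 * lam * b)
      \<le> lam * ((norm (x - y))\<^sup>2 - (norm (T x - T y))\<^sup>2)"
    by (simp add: algebra_simps power2_eq_square)
  then have le: "4 * lam * a + 4 * lam * b \<le> (norm (x - y))\<^sup>2 - (norm (T x - T y))\<^sup>2"
    using assms(3) by (rule mult_left_le_imp_le)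
  \<comment> \<open>Each inequality arises from \<open>le\<close> by discarding the other
    summand.\<close>
  have "0 \<le> 4 * lam * a" "0 \<le> 4 * lam * b"
    unfolding a_def b_def using assms(3)
    by (intro mult_nonneg_nonneg inner_resolvents_nonneg assms; simp)+
  with eq le show ?thesis
    unfolding a_def b_def RA_def by (intro conjI) linarith+
qed

end
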